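(* Let $b\geq 1$ and let $n,m$ be positive integers. Then there exists a $2nm$-fold colouring of $G_{[1,b]}$ with $$2\,\big\lceil 2n(b+1)\big\rceil\cdot\Big\lceil \tfrac{2m}{3}(b+1)\Big\rceil$$ colours.
   Context: For $b\ge 1$, $G_{[1,b]}$ is the graph with vertex set $\mathbb{R}^2$ in which two points are adjacent if and only if their Euclidean distance $d$ satisfies $1\leq d\leq b$. For positive integers $j\le k$, a $j$-fold colouring of a graph $G=(V,E)$ with $k$ colours is a map $f$ assigning to each vertex a $j$-element subset of $\{1,\dots,k\}$ such that $f(v)\cap f(w)=\emptyset$ whenever $v,w$ are adjacent; $\chi_j(G)$ is the least such $k$. *)

theory Defs
  imports "HOL-Analysis.Analysis"
begin

text \<open>A simple graph is given by its vertex set \<open>V\<close> and its set \<open>E\<close> of edges,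
  each edge being an unordered pair of distinct vertices.\<close>

definition plane_vertices :: "(real ^ 2) set" where
  "plane_vertices = UNIV"

definition plane_edges :: "real \<Rightarrow> (real ^ 2) set set" where
  "plane_edges b = {{x, y} | x y. 1 \<le> dist x y \<and> dist x y \<le> b}"

definition fold_colouring ::
  "'v set \<Rightarrow> 'v set set \<Rightarrow> nat \<Rightarrow> nat \<Rightarrow> ('v \<Rightarrow> nat set) \<Rightarrow> bool" where
  "fold_colouring V E j k f \<longleftrightarrow>
     1 \<le> j \<and> j \<le> k \<and>
     (\<forall>v\<in>V. f v \<subseteq> {1..k} \<and> card (f v) = j) \<and>
     (\<forall>v\<in>V. \<forall>w\<in>V. {v, w} \<in> E \<longrightarrow> f v \<inter> f w = {})"

end

theory Submission
  imports Defs
begin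

text \<open>Tile the plane by half-open regular hexagons of diameter 1 whose centres form a lattice.
  A finer rectangular grid is a union of \<open>2nm\<close> translates of that lattice, so every point lies in
  \<open>2nm\<close> hexagons centred at grid points. A grid point is coloured by its class modulo a roughly
  triangular sublattice of index \<open>2AB\<close> with minimal distance at least \<open>b + 1\<close>, and a vertex
  receives the colours of the hexagons containing it. Any two points of a hexagon are at distance
  strictly less than 1, so points in distinct hexagons of the same colour are at distance more
  than \<open>b\<close>.

  All computations use the coordinates \<open>s = 4x / sqrt 3\<close> and \<open>t = 4y\<close>, in which the hexagon
  centres become the points \<open>(i, 3j)\<close> with \<open>i + j\<close> even, the grid consists of the points
  \<open>(a / n, 3e / m)\<close>, and lengths are multiplied by 4.\<close>

section \<open>Euclidean length in the rescaled coordinates\<close>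

text \<open>Written with \<open>cmod\<close> so that the triangle inequality is inherited from the
  complex norm.\<close>

definition hex_norm :: "real \<Rightarrow> real \<Rightarrow> real" where
  "hex_norm s t = cmod (Complex (sqrt 3 * s) t)"

lemma hex_norm_power2: "(hex_norm s t)\<^sup>2 = 3 * s\<^sup>2 + t\<^sup>2"
  by (simp add: hex_norm_def cmod_power2 power_mult_distrib)

lemma hex_norm_nonneg: "0 \<le> hex_norm s t"
  by (simp add: hex_norm_def)

lemma hex_norm_triangle: "hex_norm (s + s') (t + t') \<le> hex_norm s t + hex_norm s' t'"
proof -
  have "Complex (sqrt 3 * (s + s')) (t + t') = Complex (sqrt 3 * s) t + Complex (sqrt 3 * s') t'"
    by (simp add: complex_eq_iff distrib_left)
  then show ?thesis by (simp add: hex_norm_def norm_triangle_ineq)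
qed

lemma hex_norm_dist:
  fixes v w :: "real ^ 2"
  shows "hex_norm (4 * v $ 1 / sqrt 3 - 4 * w $ 1 / sqrt 3) (4 * v $ 2 - 4 * w $ 2) = 4 * dist v w"
proof (rule power2_eq_imp_eq)
  have "(dist v w)\<^sup>2 = (v $ 1 - w $ 1)\<^sup>2 + (v $ 2 - w $ 2)\<^sup>2"
    by (simp add: dist_vec_def L2_set_def sum_2 dist_real_def)
  moreover have "4 * v $ 1 / sqrt 3 - 4 * w $ 1 / sqrt 3 = 4 * (v $ 1 - w $ 1) / sqrt 3"
    and "4 * v $ 2 - 4 * w $ 2 = 4 * (v $ 2 - w $ 2)"
    by (simp_all add: diff_divide_distrib right_diff_distrib)
  ultimately show "(hex_norm (4 * v $ 1 / sqrt 3 - 4 * w $ 1 / sqrt 3) (4 * v $ 2 - 4 * w $ 2))\<^sup>2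
      = (4 * dist v w)\<^sup>2"
    by (simp only: hex_norm_power2 power_mult_distrib power_divide) simp
qed (simp_all add: hex_norm_nonneg)

section \<open>The half-open hexagon: covering and diameter\<close>

text \<open>The lower slanted sides are kept and the upper ones dropped. Both vertical sides stay,
  without their top corners, so neighbouring cells overlap there; this is harmless, as only covering
  and the strict diameter bound matter.\<close>

definition hexagon :: "(real \<times> real) set" where
  "hexagon = {(s, t). \<bar>s\<bar> \<le> 1 \<and> \<bar>s\<bar> - 2 \<le> t \<and> t < 2 - \<bar>s\<bar>}"

text \<open>Reduce \<open>s\<close> modulo 2 to \<open>s'\<close> and \<open>t\<close> modulo 6. On
  this vertical line the cell at \<open>(2k, 6l)\<close> fills a segment of length
  \<open>2w\<close>; the rest of the period is exactly the segment of the cell one step towards the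
  sign of \<open>s'\<close> and 3 up.\<close>

lemma hexagon_covers:
  fixes s t :: real
  obtains i j :: int where "even (i + j)" "(s - of_int i, t - 3 * of_int j) \<in> hexagon"
proof -
  define k where "k = \<lfloor>(s + 1) / 2\<rfloor>"
  define s' where "s' = s - 2 * k"
  have s': "- 1 \<le> s'" "s' < 1"
    using floor_correct[of "(s + 1) / 2"] by (simp_all add: s'_def k_def field_simps)
  define w where "w = 2 - \<bar>s'\<bar>"
  define l where "l = \<lfloor>(t + w) / 6\<rfloor>"
  have tw: "0 \<le> t + w - 6 * l" "t + w - 6 * l < 6"
    using floor_correct[of "(t + w) / 6"] by (simp_all add: l_def field_simps)
  consider "t + w - 6 * l < 2 * w" | "2 * w \<le> t + w - 6 * l" by linarith
  then show ?thesis
  proof cases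
    case 1
    then have "(s - of_int (2 * k), t - 3 * of_int (2 * l)) \<in> hexagon"
      using s' tw by (auto simp: hexagon_def s'_def w_def)
    then show ?thesis using that[of "2 * k" "2 * l"] by simp
  next
    case 2
    define d :: int where "d = (if 0 \<le> s' then 1 else - 1)"
    have "(s - of_int (2 * k + d), t - 3 * of_int (2 * l + 1)) \<in> hexagon"
      using s' tw 2 by (auto simp: hexagon_def s'_def w_def d_def abs_if split: if_splits)
    then show ?thesis using that[of "2 * k + d" "2 * l + 1"] by (simp add: d_def)
  qed
qed

text \<open>On a slanted side the form equals \<open>4 - 4|s|(1 - |s|)\<close>, which is at most 4;
  strictly below these sides it is smaller still.\<close>

lemma norm_hexagon:
  assumes "\<bar>s\<bar> \<le> 1" "\<bar>t\<bar> \<le> 2 - \<bar>s\<bar>"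
  shows "3 * s\<^sup>2 + t\<^sup>2 \<le> 4" and "\<bar>t\<bar> < 2 - \<bar>s\<bar> \<Longrightarrow> 3 * s\<^sup>2 + t\<^sup>2 < (4 :: real)"
proof -
  have "\<bar>s\<bar>\<^sup>2 \<le> \<bar>s\<bar>"
    using mult_left_le[OF assms(1), of "\<bar>s\<bar>"] by (simp add: power2_eq_square)
  then have *: "3 * s\<^sup>2 + (2 - \<bar>s\<bar>)\<^sup>2 \<le> 4"
    by (simp add: power2_eq_square algebra_simps)
  show "3 * s\<^sup>2 + t\<^sup>2 \<le> 4"
    using power_mono[OF assms(2), of 2] * by simp
  show "3 * s\<^sup>2 + t\<^sup>2 < 4" if "\<bar>t\<bar> < 2 - \<bar>s\<bar>"
    using power_strict_mono[OF that, of 2] * by simp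
qed

text \<open>Distance 1 is attained only by antipodal points, and of two antipodal boundary points at
  most one belongs to the half-open hexagon.\<close>

lemma hexagon_diameter:
  assumes "(s, t) \<in> hexagon" "(s', t') \<in> hexagon"
  shows "hex_norm (s - s') (t - t') < 4"
proof -
  have u: "3 * s\<^sup>2 + t\<^sup>2 \<le> 4" and v: "3 * s'\<^sup>2 + t'\<^sup>2 \<le> 4"
    using assms by (auto simp: hexagon_def intro!: norm_hexagon)
  \<comment> \<open>Parallelogram law: the right-hand side is at most 16, so the difference term is
    below 16 unless the sum vanishes.\<close>
  have par: "3 * (s - s')\<^sup>2 + (t - t')\<^sup>2 + (3 * (s + s')\<^sup>2 + (t + t')\<^sup>2)
      = 2 * (3 * s\<^sup>2 + t\<^sup>2) + 2 * (3 * s'\<^sup>2 + t'\<^sup>2)"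
    by (simp add: power2_eq_square algebra_simps)
  have "3 * (s - s')\<^sup>2 + (t - t')\<^sup>2 < 16"
  proof (cases "s' = - s \<and> t' = - t")
    case True
    then have "\<bar>s\<bar> \<le> 1" "\<bar>t\<bar> < 2 - \<bar>s\<bar>"
      using assms by (auto simp: hexagon_def)
    then have "3 * s\<^sup>2 + t\<^sup>2 < 4"
      by (intro norm_hexagon) auto
    then show ?thesis using par v True by simp
  next
    case False
    then have "s + s' \<noteq> 0 \<or> t + t' \<noteq> 0" by linarith
    then have "0 < 3 * (s + s')\<^sup>2 + (t + t')\<^sup>2"
      by (auto intro: add_pos_nonneg add_nonneg_pos)
    then show ?thesis
      using par u v
      by (smt (verit))
  qed
  then have "(hex_norm (s - s') (t - t'))\<^sup>2 < 4\<^sup>2"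
    by (simp add: hex_norm_power2)
  then show ?thesis by (rule power_less_imp_less_base) simp
qed

section \<open>The colour sublattice\<close>

text \<open>The form is \<open>4(p^2 + pq + q^2)\<close>, four times a positive definite integral
  form.\<close>

lemma triangular_lattice_min:
  fixes p q :: int
  assumes "(p, q) \<noteq> (0, 0)"
  shows "4 \<le> 3 * p\<^sup>2 + (p + 2 * q)\<^sup>2"
proof -
  have pos: "1 \<le> x\<^sup>2" if "x \<noteq> 0" for x :: int
    using that by (smt (verit) zero_less_power2)
  show ?thesis
  proof (cases "p = 0")
    case True
    then show ?thesis using pos[of q] assms by (simp add: power_mult_distrib)
  next
    case False
    show ?thesis
    proof (cases "p + 2 * q = 0")
      case True
      then have "p = - 2 * q" "q \<noteq> 0" using False by auto
      then show ?thesis using pos[of q] by (simp add: power_mult_distrib)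
    next
      case q: False
      show ?thesis using pos[OF False] pos[OF q] by linarith
    qed
  qed
qed

text \<open>The class of \<open>(a, e)\<close> modulo the lattice generated by \<open>(A, B)\<close> and \<open>(0, 2B)\<close>.\<close>

definition grid_colour :: "nat \<Rightarrow> nat \<Rightarrow> int \<times> int \<Rightarrow> nat" where
  "grid_colour A B = (\<lambda>(a, e).
     nat (1 + a mod int A + int A * ((e - int B * (a div int A)) mod (2 * int B))))"

lemma grid_colour_range:
  assumes "0 < A" "0 < B"
  shows "grid_colour A B g \<in> {1..2 * A * B}"
proof -
  obtain a e where g: "g = (a, e)" by fastforce
  define x where "x = a mod int A"
  define y where "y = (e - int B * (a div int A)) mod (2 * int B)"
  have x: "0 \<le> x" "x < int A" and y: "0 \<le> y" "y < 2 * int B"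
    using assms by (auto simp: x_def y_def)
  have "int A * y \<le> int A * (2 * int B - 1)"
    using y by (intro mult_left_mono) auto
  then have "1 + x + int A * y \<le> int (2 * A * B)"
    using x by (simp add: algebra_simps)
  moreover have "0 \<le> int A * y" using y by simp
  ultimately show ?thesis
    using x by (auto simp: grid_colour_def g nat_le_iff simp flip: x_def y_def)
qed

lemma grid_colour_eqD:
  assumes "0 < A" "0 < B" and eq: "grid_colour A B (a, e) = grid_colour A B (a', e')"
  obtains p q :: int where "a - a' = int A * p" "e - e' = int B * (p + 2 * q)"
proof -
  define x where "x = (\<lambda>a. a mod int A)"
  define y where "y = (\<lambda>a e. (e - int B * (a div int A)) mod (2 * int B))"
  have x: "0 \<le> x a" "x a < int A" for a
    using assms by (auto simp: x_def)
  have y: "0 \<le> y a e" for a e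
    using assms by (auto simp: y_def)
  have nn: "0 \<le> int A * y a e" for a e
    using y by simp
  have "x a + int A * y a e = x a' + int A * y a' e'"
    using eq x(1)[of a] x(1)[of a'] nn[of a e] nn[of a' e']
    by (simp add: grid_colour_def x_def y_def nat_eq_iff)
  \<comment> \<open>As \<open>x\<close> lies in \<open>[0, A)\<close>, remainder and quotient by
    \<open>A\<close> recover both digits of the colour.\<close>
  then have "(x a + int A * y a e) mod int A = (x a' + int A * y a' e') mod int A"
    and "(x a + int A * y a e) div int A = (x a' + int A * y a' e') div int A"
    by simp_all
  then have xx: "x a = x a'" and yy: "y a e = y a' e'"
    using x assms(1) by auto
  define p where "p = a div int A - a' div int A"
  have "a = int A * (a div int A) + x a" "a' = int A * (a' div int A) + x a'"
    by (simp_all add: x_def)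
  then have "a - a' = int A * p"
    using xx by (simp add: p_def algebra_simps)
  moreover have "2 * int B dvd (e - int B * (a div int A)) - (e' - int B * (a' div int A))"
    using yy by (simp add: y_def mod_eq_dvd_iff)
  then obtain q where "(e - int B * (a div int A)) - (e' - int B * (a' div int A)) = 2 * int B * q"
    by blast
  then have "e - e' = int B * (p + 2 * q)"
    by (simp add: p_def algebra_simps)
  ultimately show ?thesis by (rule that)
qed

lemma same_colour_hexagons_far:
  fixes b s t s' t' :: real and n m A B :: nat
  assumes "0 < n" "0 < m" "0 \<le> b" "2 * real n * (b + 1) \<le> A" "2 * real m / 3 * (b + 1) \<le> B"
    and col: "grid_colour A B (a, e) = grid_colour A B (a', e')" and ne: "(a, e) \<noteq> (a', e')"
    and "(s - a / n, t - 3 * of_int e / m) \<in> hexagon" "(s' - a' / n, t' - 3 * of_int e' / m) \<in> hexagon"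
  shows "4 * b < hex_norm (s - s') (t - t')"
proof -
  have "0 < 2 * real n * (b + 1)" "0 < 2 * real m / 3 * (b + 1)"
    using assms(1-3) by simp_all
  then have "0 < A" "0 < B" using assms(4,5) by linarith+
  then obtain p q where p: "a - a' = int A * p" and q: "e - e' = int B * (p + 2 * q)"
    using col by (rule grid_colour_eqD)
  define ds where "ds = real_of_int a / n - a' / n"
  define dt where "dt = 3 * real_of_int e / m - 3 * of_int e' / m"
  have "(p, q) \<noteq> (0, 0)" using ne p q by auto
  then have pq: "4 \<le> 3 * (real_of_int p)\<^sup>2 + (real_of_int (p + 2 * q))\<^sup>2"
    using of_int_le_iff[where 'a = real, THEN iffD2, OF triangular_lattice_min[of p q]] by simp
  have "ds = real_of_int (a - a') / n" "dt = 3 * real_of_int (e - e') / m"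
    by (simp_all add: ds_def dt_def diff_divide_distrib right_diff_distrib)
  then have ds: "ds = (A / n) * p" and dt: "dt = (3 * B / m) * real_of_int (p + 2 * q)"
    unfolding p q by simp_all
  \<comment> \<open>The sizes of \<open>A\<close> and \<open>B\<close> are chosen for this: both
    axis scalings of the sublattice are at least \<open>2(b + 1)\<close>, so its nonzero vectors
    have norm at least \<open>4(b + 1)\<close>.\<close>
  have "2 * (b + 1) \<le> A / n" "2 * (b + 1) \<le> 3 * B / m"
    using assms by (simp_all add: field_simps)
  then have "(2 * (b + 1))\<^sup>2 \<le> (A / n)\<^sup>2" "(2 * (b + 1))\<^sup>2 \<le> (3 * B / m)\<^sup>2"
    using \<open>0 \<le> b\<close> by (auto intro!: power_mono)
  then have "(2 * (b + 1))\<^sup>2 * (real_of_int p)\<^sup>2 \<le> ds\<^sup>2"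
      "(2 * (b + 1))\<^sup>2 * (real_of_int (p + 2 * q))\<^sup>2 \<le> dt\<^sup>2"
    unfolding ds dt power_mult_distrib[of _ "real_of_int _"] by (intro mult_right_mono; simp)+
  then have "(2 * (b + 1))\<^sup>2 * (3 * (real_of_int p)\<^sup>2 + (real_of_int (p + 2 * q))\<^sup>2)
      \<le> 3 * ds\<^sup>2 + dt\<^sup>2"
    by (simp only: distrib_left)
  moreover have "(2 * (b + 1))\<^sup>2 * 4
      \<le> (2 * (b + 1))\<^sup>2 * (3 * (real_of_int p)\<^sup>2 + (real_of_int (p + 2 * q))\<^sup>2)"
    using pq by (intro mult_left_mono) auto
  ultimately have "(2 * (b + 1))\<^sup>2 * 4 \<le> (hex_norm ds dt)\<^sup>2"
    unfolding hex_norm_power2 by linarith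
  then have "(4 * (b + 1))\<^sup>2 \<le> (hex_norm ds dt)\<^sup>2"
    unfolding power_mult_distrib by simp
  then have "4 * (b + 1) \<le> hex_norm ds dt"
    by (rule power2_le_imp_le) (rule hex_norm_nonneg)
  \<comment> \<open>Both offsets from the centres lie in the same hexagon at the origin, so together
    they cost less than one diameter, 4, rather than two.\<close>
  also have "\<dots> \<le> hex_norm (s - s') (t - t')
      + hex_norm ((s' - a' / n) - (s - a / n)) ((t' - 3 * of_int e' / m) - (t - 3 * of_int e / m))"
    by (rule order_trans[OF _ hex_norm_triangle]) (simp add: ds_def dt_def)
  also have "\<dots> < hex_norm (s - s') (t - t') + 4"
    using hexagon_diameter[OF assms(9,8)] by simp
  finally show ?thesis by simp
qed

section \<open>Choice of hexagons and the colouring\<close>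

theorem theorem7:
  fixes b :: real and n m :: nat
  assumes "1 \<le> b" and "1 \<le> n" and "1 \<le> m"
  shows "\<exists>f. fold_colouring plane_vertices (plane_edges b) (2 * n * m)
           (2 * nat \<lceil>2 * real n * (b + 1)\<rceil> * nat \<lceil>2 * real m / 3 * (b + 1)\<rceil>) f"
proof -
  define A where "A = nat \<lceil>2 * real n * (b + 1)\<rceil>"
  define B where "B = nat \<lceil>2 * real m / 3 * (b + 1)\<rceil>"
  have A: "2 * real n * (b + 1) \<le> A" and B: "2 * real m / 3 * (b + 1) \<le> B"
    unfolding A_def B_def by (rule real_nat_ceiling_ge)+
  have "0 < 2 * real n * (b + 1)" "0 < 2 * real m / 3 * (b + 1)"
    using assms by simp_all
  then have pos: "0 < A" "0 < B" using A B by linarith+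
  define S :: "real ^ 2 \<Rightarrow> real" where "S v = 4 * v $ 1 / sqrt 3" for v
  define T :: "real ^ 2 \<Rightarrow> real" where "T v = 4 * v $ 2" for v
  have ST: "hex_norm (S v - S w) (T v - T w) = 4 * dist v w" for v w
    unfolding S_def T_def by (rule hex_norm_dist)
  define cell where "cell v = (\<lambda>(a :: int, e :: int). (S v - a / n, T v - 3 * of_int e / m) \<in> hexagon)" for v
  have far: "b < dist v w"
    if "cell v g" "cell w g'" "grid_colour A B g = grid_colour A B g'" "g \<noteq> g'" for v w g g'
    using that same_colour_hexagons_far[of n m b A B "fst g" "snd g" "fst g'" "snd g'" "S v" "T v" "S w" "T w"]
      assms A B by (auto simp: cell_def ST split: prod.splits)
  have near: "dist v w < 1" if "cell v g" "cell w g" for v w g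
    using that hexagon_diameter[of "S v - fst g / n" "T v - 3 * of_int (snd g) / m" "S w - fst g / n" "T w - 3 * of_int (snd g) / m"]
    by (auto simp: cell_def ST split: prod.splits)
  \<comment> \<open>Representatives of the \<open>2nm\<close> cosets, in the grid, of the lattice of
    points \<open>(n i, m j)\<close> with \<open>i + j\<close> even; each coset supplies a covering
    by hexagons.\<close>
  define I where "I = {0..<2 * int n} \<times> {0..<int m}"
  have "\<exists>i j. even (i + j) \<and> cell v (k + int n * i, l + int m * j)" for v k l
  proof -
    obtain i j where "even (i + j)" and
      ij: "(S v - k / n - of_int i, T v - 3 * of_int l / m - 3 * of_int j) \<in> hexagon"
      by (rule hexagon_covers)
    moreover have "S v - k / n - of_int i = S v - of_int (k + int n * i) / n"
      and "T v - 3 * of_int l / m - 3 * of_int j = T v - 3 * of_int (l + int m * j) / m"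
      using assms by (simp_all add: field_simps)
    ultimately show ?thesis by (auto simp: cell_def)
  qed
  then obtain i j where even: "\<And>v k l. even (i v k l + j v k l)"
    and cell: "\<And>v k l. cell v (k + int n * i v k l, l + int m * j v k l)"
    by metis
  define g where "g v = (\<lambda>(k, l). (k + int n * i v k l, l + int m * j v k l))" for v
  have cell_g: "cell v (g v x)" for v x
    using cell by (simp add: g_def split: prod.splits)
  have inj_g: "inj_on (g v) I" for v
  proof (rule inj_onI)
    fix x x' assume x: "x \<in> I" "x' \<in> I" and eq: "g v x = g v x'"
    obtain k l k' l' where kl: "x = (k, l)" "x' = (k', l')" by fastforce
    define i1 j1 i2 j2 where ij: "i1 = i v k l" "j1 = j v k l" "i2 = i v k' l'" "j2 = j v k' l'"
    have eqs: "k + int n * i1 = k' + int n * i2" "l + int m * j1 = l' + int m * j2"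
      using eq by (simp_all add: g_def kl ij)
    have b: "0 \<le> k" "k < 2 * int n" "0 \<le> k'" "k' < 2 * int n" "0 \<le> l" "l < int m" "0 \<le> l'" "l' < int m"
      using x by (auto simp: I_def kl)
    have "l = (l + int m * j1) mod int m" using b by simp
    also have "\<dots> = l'" unfolding eqs using b by simp
    finally have l: "l = l'" .
    then have "j1 = j2" using eqs assms by simp
    \<comment> \<open>Parity improves the congruence of \<open>k\<close> and \<open>k'\<close> from
      modulo \<open>n\<close> to modulo \<open>2n\<close>, which is why \<open>k\<close> may range
      over \<open>2n\<close> values.\<close>
    then have "even (i2 - i1)" using even[of v k l] even[of v k' l'] by (simp add: ij)
    then obtain r where "i2 = i1 + 2 * r" by (metis add.commute diff_add_cancel dvdE)
    then have "k = k' + 2 * int n * r" using eqs by (simp add: algebra_simps)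
    then have "k mod (2 * int n) = k' mod (2 * int n)" by simp
    then show "x = x'" using b l by (simp add: kl)
  qed
  define f where "f v = (\<lambda>x. grid_colour A B (g v x)) ` I" for v
  have "inj_on (\<lambda>x. grid_colour A B (g v x)) I" for v
  proof (rule inj_onI)
    fix x x' assume "x \<in> I" "x' \<in> I" "grid_colour A B (g v x) = grid_colour A B (g v x')"
    \<comment> \<open>Otherwise \<open>far\<close>, applied with both points equal to
      \<open>v\<close>, would give \<open>b < 0\<close>.\<close>
    moreover from this have "g v x = g v x'"
      using far[OF cell_g[of v x] cell_g[of v x']] assms(1) by fastforce
    ultimately show "x = x'" using inj_onD[OF inj_g] by blast
  qed
  then have card: "card (f v) = 2 * n * m" for v
    by (simp add: f_def card_image I_def card_cartesian_product nat_mult_distrib)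
  have sub: "f v \<subseteq> {1..2 * A * B}" for v
    unfolding f_def using grid_colour_range[OF pos] by blast
  have "2 * n * m \<le> 2 * A * B"
    using card_mono[OF _ sub[of 0]] card by simp
  moreover have "f v \<inter> f w = {}" if "{v, w} \<in> plane_edges b" for v w
  proof -
    have d: "1 \<le> dist v w" "dist v w \<le> b"
      using that by (auto simp: plane_edges_def doubleton_eq_iff dist_commute)
    \<comment> \<open>With equal colours, a common cell would force distance below 1, and distinct
      cells distance above \<open>b\<close>.\<close>
    have "grid_colour A B (g v x) \<noteq> grid_colour A B (g w y)" for x y
      using far[OF cell_g[of v x] cell_g[of w y]] near[OF cell_g[of v x], of w] cell_g[of w y] d
      by (cases "g v x = g w y") auto
    then show ?thesis by (auto simp: f_def)
  qed
  ultimately have "fold_colouring plane_vertices (plane_edges b) (2 * n * m) (2 * A * B) f"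
    using card sub assms by (auto simp: fold_colouring_def)
  then show ?thesis unfolding A_def B_def by blast
qed

end
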